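(* For every positive integer $n$, the relation $SC^{\mathbb{R}^n}$ (restricted to polytopes) is a contact relation in the Boolean algebra $\mathcal{P}^n=\langle P^n,{}^*,\cup\rangle$ of polytopes in $\mathbb{R}^n$.
   Context: $\mathbb{R}^n$ carries its usual topology, with interior $\mathrm{Int}$ and closure $\mathrm{Cl}$. A set $A\subseteq\mathbb{R}^n$ is regular closed if $A=\mathrm{Cl}(\mathrm{Int}(A))$. The regularised intersection of finitely many regular closed sets $A_1,\dots,A_k$ is $\mathrm{Cl}(\mathrm{Int}(A_1\cap\dots\cap A_k))$; for two sets, $A\sqcap B=\mathrm{Cl}(\mathrm{Int}(A\cap B))$. Put $A^*=\mathrm{Cl}(\mathbb{R}^n\setminus A)$. A basic polytope in $\mathbb{R}^n$ is a regularised intersection of finitely many closed half-spaces of $\mathbb{R}^n$; a polytope in $\mathbb{R}^n$ is a finite union of basic polytopes. $P^n$ is the set of polytopes in $\mathbb{R}^n$. $\mathcal{P}^n=\langle P^n,{}^*,\cup\rangle$ is a Boolean algebra with complement ${}^*$, join $\cup$, meet $\sqcap$, zero $\emptyset$, unit $\mathbb{R}^n$. For subsets $A,B$ of $\mathbb{R}^n$, $SC^{\mathbb{R}^n}(A,B)$ holds iff there is a connected open set $E\subseteq A\cup B$ with $E\cap A\neq\emptyset$ and $E\cap B\neq\emptyset$. A contact relation in a Boolean algebra with carrier $A$, zero $0$ and join $+$ is a binary relation $C$ in $A$ such that for all $x,y,z\in A$: (C1) not $C(0,x)$; (C2) $C(x,y+z)$ iff ($C(x,y)$ or $C(x,z)$);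 (C3) $C(x,y)$ implies $C(y,x)$; (C4) $x\ne 0$ implies $C(x,x)$. *)

theory Defs
  imports "HOL-Analysis.Analysis"
begin

(* The axioms are those of the locale abstract_boolean_algebra from HOL, relativised to a carrier. *)
locale boolean_algebra_on =
  fixes carrier :: "'a set"
    and meet :: "'a \<Rightarrow> 'a \<Rightarrow> 'a"
    and join :: "'a \<Rightarrow> 'a \<Rightarrow> 'a"
    and compl :: "'a \<Rightarrow> 'a"
    and zero :: "'a"
    and one :: "'a"
  assumes meet_closed: "\<lbrakk>x \<in> carrier; y \<in> carrier\<rbrakk> \<Longrightarrow> meet x y \<in> carrier"
    and join_closed: "\<lbrakk>x \<in> carrier; y \<in> carrier\<rbrakk> \<Longrightarrow> join x y \<in> carrier"
    and compl_closed: "x \<in> carrier \<Longrightarrow> compl x \<in> carrier"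
    and zero_closed: "zero \<in> carrier"
    and one_closed: "one \<in> carrier"
    and meet_assoc: "\<lbrakk>x \<in> carrier; y \<in> carrier; z \<in> carrier\<rbrakk>
          \<Longrightarrow> meet (meet x y) z = meet x (meet y z)"
    and join_assoc: "\<lbrakk>x \<in> carrier; y \<in> carrier; z \<in> carrier\<rbrakk>
          \<Longrightarrow> join (join x y) z = join x (join y z)"
    and meet_commute: "\<lbrakk>x \<in> carrier; y \<in> carrier\<rbrakk> \<Longrightarrow> meet x y = meet y x"
    and join_commute: "\<lbrakk>x \<in> carrier; y \<in> carrier\<rbrakk> \<Longrightarrow> join x y = join y x"
    and meet_join_distrib: "\<lbrakk>x \<in> carrier; y \<in> carrier; z \<in> carrier\<rbrakk>
          \<Longrightarrow> meet x (join y z) = join (meet x y) (meet x z)"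
    and join_meet_distrib: "\<lbrakk>x \<in> carrier; y \<in> carrier; z \<in> carrier\<rbrakk>
          \<Longrightarrow> join x (meet y z) = meet (join x y) (join x z)"
    and meet_one: "x \<in> carrier \<Longrightarrow> meet x one = x"
    and join_zero: "x \<in> carrier \<Longrightarrow> join x zero = x"
    and meet_compl: "x \<in> carrier \<Longrightarrow> meet x (compl x) = zero"
    and join_compl: "x \<in> carrier \<Longrightarrow> join x (compl x) = one"

locale contact_relation = boolean_algebra_on carrier meet join compl zero one
  for carrier :: "'a set"
    and meet :: "'a \<Rightarrow> 'a \<Rightarrow> 'a"
    and join :: "'a \<Rightarrow> 'a \<Rightarrow> 'a"
    and compl :: "'a \<Rightarrow> 'a"
    and zero :: "'a"
    and one :: "'a" +
  fixes C :: "('a \<times> 'a) set"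
  assumes C_on: "C \<subseteq> carrier \<times> carrier"
    and C1: "x \<in> carrier \<Longrightarrow> (zero, x) \<notin> C"
    and C2: "\<lbrakk>x \<in> carrier; y \<in> carrier; z \<in> carrier\<rbrakk>
          \<Longrightarrow> (x, join y z) \<in> C \<longleftrightarrow> (x, y) \<in> C \<or> (x, z) \<in> C"
    and C3: "\<lbrakk>x \<in> carrier; y \<in> carrier; (x, y) \<in> C\<rbrakk> \<Longrightarrow> (y, x) \<in> C"
    and C4: "\<lbrakk>x \<in> carrier; x \<noteq> zero\<rbrakk> \<Longrightarrow> (x, x) \<in> C"

definition reg_Inter :: "'a::topological_space set set \<Rightarrow> 'a set" where
  "reg_Inter F = closure (interior (\<Inter>F))"

definition reg_meet :: "'a::topological_space set \<Rightarrow> 'a set \<Rightarrow> 'a set" where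
  "reg_meet A B = closure (interior (A \<inter> B))"

definition reg_compl :: "'a::topological_space set \<Rightarrow> 'a set" where
  "reg_compl A = closure (- A)"

definition closed_halfspace :: "'a::euclidean_space set \<Rightarrow> bool" where
  "closed_halfspace H \<longleftrightarrow> (\<exists>a b. a \<noteq> 0 \<and> H = {x. a \<bullet> x \<le> b})"

(* The empty family is allowed and yields the whole space. This does not affect the set of
   polytopes: the whole space is also the union of two opposite half-spaces. *)
definition basic_polytope :: "'a::euclidean_space set \<Rightarrow> bool" where
  "basic_polytope Q \<longleftrightarrow> (\<exists>F. finite F \<and> (\<forall>H\<in>F. closed_halfspace H) \<and> Q = reg_Inter F)"

(* Unlike the predicate polytope of HOL-Analysis (the convex hull of a finite set), polytopes
   here may be unbounded, non-convex and disconnected. *)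
definition polytopes :: "'a::euclidean_space set set" where
  "polytopes = {\<Union>F | F. finite F \<and> (\<forall>Q\<in>F. basic_polytope Q)}"

definition SC :: "'a::topological_space set \<Rightarrow> 'a set \<Rightarrow> bool" where
  "SC A B \<longleftrightarrow> (\<exists>E. open E \<and> connected E \<and> E \<subseteq> A \<union> B \<and> E \<inter> A \<noteq> {} \<and> E \<inter> B \<noteq> {})"

end

theory Submission
  imports Defs
begin

text \<open>
  Polytopes are regular closed, and their boundaries lie in finitely many hyperplanes, hence are
  null sets. Two regular closed sets that agree outside a null set are equal, and outside the
  boundaries of the arguments \<open>reg_meet\<close> and \<open>reg_compl\<close> are ordinary intersection and
  complement. So every Boolean law for polytopes reduces to the same law for sets
  (\<open>flat_boundary_eqI\<close>). Closure of the polytopes under \<open>reg_meet\<close> and \<open>reg_compl\<close> follows from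
  such laws too: distributivity and De Morgan reduce it to half-spaces.

  Of the contact axioms only one is substantial: a connected open \<open>E \<subseteq> X \<union> Y \<union> Z\<close> that
  meets \<open>X\<close> and \<open>Y \<union> Z\<close> must yield a connected open set that joins \<open>X\<close> to \<open>Y\<close> inside
  \<open>X \<union> Y\<close>, or \<open>X\<close> to \<open>Z\<close> inside \<open>X \<union> Z\<close>. A small ball will do, if it is centred at a point \<open>p\<close>
  common to \<open>X\<close> and \<open>Y \<union> Z\<close> that lies on at most one of the hyperplanes carrying the
  boundaries. Such a ball is cut by a single hyperplane into two halves, and each of the three sets
  contains or misses each open half. If \<open>p\<close> lies in \<open>X\<close> and \<open>Y\<close>, each of these contains a half;
  either they cover the ball together, or one half is missed by both, so belongs to \<open>Z\<close>, and then
  \<open>X\<close> and \<open>Z\<close> cover the ball (\<open>SC_Un_at_generic_point\<close>).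

  The point \<open>p\<close> exists because the points on two of the hyperplanes form a set of codimension two,
  which segments in general position avoid (\<open>generic_segment\<close>). Connectedness of \<open>E\<close> gives some
  common point \<open>q\<close> of \<open>X\<close> and \<open>Y \<union> Z\<close>, perhaps a bad one. Every ball about \<open>q\<close> meets the
  interiors of both sets, so a generic segment in the ball leads from one interior to the other;
  being connected and covered by the two closed sets, it contains a point of both.
\<close>

section \<open>Regular closed sets\<close>

definition regular_closed :: "'a::topological_space set \<Rightarrow> bool" where
  "regular_closed A \<longleftrightarrow> closure (interior A) = A"

lemma regular_closed_imp_closed: "regular_closed A \<Longrightarrow> closed A"
  unfolding regular_closed_def by (metis closed_closure)

lemma regular_closed_closure_open:
  assumes "open U"
  shows "regular_closed (closure U)"
proof -
  have "U \<subseteq> interior (closure U)"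
    using assms closure_subset by (rule interior_maximal[rotated])
  moreover have "closure (interior (closure U)) \<subseteq> closure U"
    by (simp add: closure_minimal interior_subset)
  ultimately show ?thesis
    unfolding regular_closed_def by (metis closure_mono subset_antisym)
qed

lemma regular_closed_reg_Inter: "regular_closed (reg_Inter F)"
  unfolding reg_Inter_def by (intro regular_closed_closure_open open_interior)

lemma regular_closed_reg_compl: "closed A \<Longrightarrow> regular_closed (reg_compl A)"
  by (simp add: reg_compl_def regular_closed_closure_open open_Compl)

lemma regular_closed_Union:
  assumes "finite F" and reg: "\<And>A. A \<in> F \<Longrightarrow> regular_closed A"
  shows "regular_closed (\<Union>F)"
proof -
  have "closed (\<Union>F)"
    using assms by (intro closed_Union) (auto simp: regular_closed_imp_closed)
  then have "closure (interior (\<Union>F)) \<subseteq> \<Union>F"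
    by (simp add: closure_minimal interior_subset)
  moreover have "A \<subseteq> closure (interior (\<Union>F))" if "A \<in> F" for A
    using that reg unfolding regular_closed_def
    by (metis Union_upper closure_mono interior_mono)
  ultimately show ?thesis
    unfolding regular_closed_def by blast
qed

lemma open_meets_interior:
  assumes "regular_closed A" "open U" "U \<inter> A \<noteq> {}"
  shows "U \<inter> interior A \<noteq> {}"
  using assms unfolding regular_closed_def by (metis open_Int_closure_eq_empty)

lemma notin_frontier_cases: "x \<notin> frontier A \<Longrightarrow> x \<in> interior A \<or> x \<in> interior (- A)"
  by (auto simp: frontier_def interior_complement)

lemma interior_Inter_finite:
  assumes "finite F"
  shows "interior (\<Inter>F) = (\<Inter>A\<in>F. interior A)"
  using assms by (induction F) auto

text \<open>
  The regularisation only discards boundary points: away from all boundaries, a point of the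
  intersection is interior to every member, hence to the intersection.
\<close>
lemma reg_Inter_off_frontiers:
  assumes "finite F" "\<And>A. A \<in> F \<Longrightarrow> closed A" "\<And>A. A \<in> F \<Longrightarrow> x \<notin> frontier A"
  shows "x \<in> reg_Inter F \<longleftrightarrow> x \<in> \<Inter>F"
proof
  assume "x \<in> reg_Inter F"
  moreover have "closure (interior (\<Inter>F)) \<subseteq> \<Inter>F"
    using assms(2) by (intro closure_minimal interior_subset) auto
  ultimately show "x \<in> \<Inter>F"
    by (auto simp: reg_Inter_def)
next
  assume "x \<in> \<Inter>F"
  then have "x \<in> (\<Inter>A\<in>F. interior A)"
    using assms(3) interior_subset by (fastforce dest: notin_frontier_cases)
  also have "(\<Inter>A\<in>F. interior A) = interior (\<Inter>F)"
    using assms(1) by (simp add: interior_Inter_finite)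
  finally show "x \<in> reg_Inter F"
    unfolding reg_Inter_def using closure_subset by blast
qed

lemma reg_meet_eq_reg_Inter: "reg_meet A B = reg_Inter {A, B}"
  by (simp add: reg_meet_def reg_Inter_def)

lemma reg_meet_off_frontiers:
  assumes "closed A" "closed B" "x \<notin> frontier A" "x \<notin> frontier B"
  shows "x \<in> reg_meet A B \<longleftrightarrow> x \<in> A \<and> x \<in> B"
  unfolding reg_meet_eq_reg_Inter using assms by (subst reg_Inter_off_frontiers) auto

lemma reg_compl_off_frontier:
  assumes "x \<notin> frontier A"
  shows "x \<in> reg_compl A \<longleftrightarrow> x \<notin> A"
  using notin_frontier_cases[OF assms] interior_subset
  by (fastforce simp: reg_compl_def interior_complement closure_complement)

lemma frontier_closure_interior_subset: "frontier (closure (interior A)) \<subseteq> frontier A"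
proof -
  have "closure (interior A) \<subseteq> closure A"
    by (simp add: closure_mono interior_subset)
  moreover have "interior A \<subseteq> interior (closure (interior A))"
    by (simp add: closure_subset interior_maximal)
  ultimately show ?thesis
    by (auto simp: frontier_def)
qed

lemma frontier_Inter_subset:
  assumes "finite F"
  shows "frontier (\<Inter>F) \<subseteq> (\<Union>A\<in>F. frontier A)"
proof
  fix x assume x: "x \<in> frontier (\<Inter>F)"
  then have "x \<notin> (\<Inter>A\<in>F. interior A)"
    using assms by (simp add: frontier_def interior_Inter_finite)
  then obtain A where A: "A \<in> F" "x \<notin> interior A" by blast
  moreover have "x \<in> closure A"
    using x A(1) closure_mono[of "\<Inter>F" A] by (auto simp: frontier_def)
  ultimately show "x \<in> (\<Union>A\<in>F. frontier A)"
    by (auto simp: frontier_def)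
qed

lemma frontier_reg_Inter_subset:
  assumes "finite F"
  shows "frontier (reg_Inter F) \<subseteq> (\<Union>A\<in>F. frontier A)"
  unfolding reg_Inter_def
  using frontier_closure_interior_subset frontier_Inter_subset[OF assms] by (rule order_trans)

lemma frontier_reg_meet_subset: "frontier (reg_meet A B) \<subseteq> frontier A \<union> frontier B"
  unfolding reg_meet_eq_reg_Inter using frontier_reg_Inter_subset[of "{A, B}"] by simp

lemma frontier_reg_compl_subset:
  assumes "closed A"
  shows "frontier (reg_compl A) \<subseteq> frontier A"
  using frontier_closure_interior_subset[of "- A"] assms
  by (simp add: reg_compl_def interior_open open_Compl frontier_complement)

section \<open>Sets with flat boundary\<close>

definition hyperplane :: "'a::euclidean_space set \<Rightarrow> bool" where
  "hyperplane h \<longleftrightarrow> (\<exists>c d. c \<noteq> 0 \<and> h = {x. c \<bullet> x = d})"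

lemma hyperplane_closed: "hyperplane h \<Longrightarrow> closed h"
  by (auto simp: hyperplane_def closed_hyperplane)

lemma hyperplane_negligible: "hyperplane h \<Longrightarrow> negligible h"
  by (auto simp: hyperplane_def negligible_hyperplane)

text \<open>
  The only geometric property of polytopes that the contact axioms depend on: the hyperplanes make
  the boundary a null set and give general position a meaning.
\<close>
definition flat_boundary :: "'a::euclidean_space set \<Rightarrow> bool" where
  "flat_boundary A \<longleftrightarrow>
     regular_closed A \<and> (\<exists>\<H>. finite \<H> \<and> (\<forall>h\<in>\<H>. hyperplane h) \<and> frontier A \<subseteq> \<Union>\<H>)"

lemma flat_boundary_regular_closed: "flat_boundary A \<Longrightarrow> regular_closed A"
  by (simp add: flat_boundary_def)

lemma flat_boundary_closed: "flat_boundary A \<Longrightarrow> closed A"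
  by (simp add: flat_boundary_def regular_closed_imp_closed)

lemma flat_boundary_negligible_frontier:
  assumes "flat_boundary A"
  shows "negligible (frontier A)"
  using assms negligible_Union hyperplane_negligible negligible_subset
  unfolding flat_boundary_def by metis

text \<open>
  No operation of the algebra creates boundary beyond that of its arguments, so this one rule gives
  closure under each of them.
\<close>
lemma flat_boundary_if_frontier_covered:
  assumes "regular_closed A" "finite F" "\<And>B. B \<in> F \<Longrightarrow> flat_boundary B"
    and "frontier A \<subseteq> (\<Union>B\<in>F. frontier B)"
  shows "flat_boundary A"
proof -
  have "\<forall>B\<in>F. \<exists>\<H>. finite \<H> \<and> (\<forall>h\<in>\<H>. hyperplane h) \<and> frontier B \<subseteq> \<Union>\<H>"
    using assms(3) by (simp add: flat_boundary_def)
  then obtain \<H> where \<H>: "\<forall>B\<in>F. finite (\<H> B) \<and> (\<forall>h\<in>\<H> B. hyperplane h) \<and> frontier B \<subseteq> \<Union>(\<H> B)"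
    by metis
  show ?thesis
    unfolding flat_boundary_def
  proof (intro conjI exI[of _ "\<Union>B\<in>F. \<H> B"])
    show "frontier A \<subseteq> \<Union>(\<Union>B\<in>F. \<H> B)"
      using assms(4) \<H> by (blast dest: subsetD)
  qed (use assms(1,2) \<H> in auto)
qed

lemma flat_boundary_Union:
  assumes "finite F" "\<And>A. A \<in> F \<Longrightarrow> flat_boundary A"
  shows "flat_boundary (\<Union>F)"
  by (rule flat_boundary_if_frontier_covered[OF _ assms(1) _ frontier_Union_subset[OF assms(1)]])
    (use assms in \<open>auto intro: regular_closed_Union flat_boundary_regular_closed\<close>)

lemma flat_boundary_Un:
  assumes "flat_boundary A" "flat_boundary B"
  shows "flat_boundary (A \<union> B)"
  using flat_boundary_Union[of "{A, B}"] assms by auto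

lemma flat_boundary_reg_Inter:
  assumes "finite F" "\<And>A. A \<in> F \<Longrightarrow> flat_boundary A"
  shows "flat_boundary (reg_Inter F)"
  by (rule flat_boundary_if_frontier_covered[OF regular_closed_reg_Inter assms(1) _
      frontier_reg_Inter_subset[OF assms(1)]])
    (rule assms(2))

lemma flat_boundary_reg_meet:
  assumes "flat_boundary A" "flat_boundary B"
  shows "flat_boundary (reg_meet A B)"
  unfolding reg_meet_eq_reg_Inter using assms by (intro flat_boundary_reg_Inter) auto

lemma flat_boundary_reg_compl:
  assumes "flat_boundary A"
  shows "flat_boundary (reg_compl A)"
  by (rule flat_boundary_if_frontier_covered[where F = "{A}"])
    (use assms frontier_reg_compl_subset[OF flat_boundary_closed[OF assms]] in
      \<open>auto intro: regular_closed_reg_compl flat_boundary_closed\<close>)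

lemma flat_boundary_empty: "flat_boundary {}"
  using flat_boundary_Union[of "{}"] by auto

lemma flat_boundary_UNIV: "flat_boundary UNIV"
  using flat_boundary_reg_Inter[of "{}"] by (simp add: reg_Inter_def)

lemma flat_boundary_closed_halfspace:
  assumes "closed_halfspace H"
  shows "flat_boundary H"
proof -
  obtain c d where c: "c \<noteq> 0" and H: "H = {x. c \<bullet> x \<le> d}"
    using assms by (auto simp: closed_halfspace_def)
  have "regular_closed H"
    using c by (simp add: regular_closed_def H)
  moreover have "frontier H = {x. c \<bullet> x = d}"
    using c by (simp add: H frontier_halfspace_le)
  ultimately show ?thesis
    unfolding flat_boundary_def using c
    by (intro conjI exI[of _ "{{x. c \<bullet> x = d}}"]) (auto simp: hyperplane_def)
qed

section \<open>The Boolean algebra of polytopes\<close>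

lemma open_meets_Compl_negligible:
  fixes U :: "'a::euclidean_space set"
  assumes "open U" "U \<noteq> {}" "negligible N"
  obtains x where "x \<in> U" "x \<notin> N"
  using assms by (metis negligible_subset open_not_negligible subsetI)

text \<open>
  Nonempty open sets are not negligible, so the open set \<open>interior A - B\<close> must be empty; a regular
  closed set is the closure of its interior.
\<close>
lemma regular_closed_subset_almost:
  fixes A B :: "'a::euclidean_space set"
  assumes "regular_closed A" "regular_closed B" "negligible N"
    and "\<And>x. x \<notin> N \<Longrightarrow> x \<in> A \<Longrightarrow> x \<in> B"
  shows "A \<subseteq> B"
proof -
  have "interior A - B = {}"
  proof (rule ccontr)
    assume "interior A - B \<noteq> {}"
    moreover have "open (interior A - B)"
      using assms(2) by (simp add: open_Diff regular_closed_imp_closed)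
    ultimately obtain x where "x \<in> interior A - B" "x \<notin> N"
      using open_meets_Compl_negligible assms(3) by metis
    then show False
      using assms(4) interior_subset by blast
  qed
  then have "closure (interior A) \<subseteq> B"
    using assms(2) by (intro closure_minimal) (auto simp: regular_closed_imp_closed)
  then show ?thesis
    using assms(1) by (simp add: regular_closed_def)
qed

lemma regular_closed_eq_almost:
  fixes A B :: "'a::euclidean_space set"
  assumes "regular_closed A" "regular_closed B" "negligible N"
    and "\<And>x. x \<notin> N \<Longrightarrow> x \<in> A \<longleftrightarrow> x \<in> B"
  shows "A = B"
  using assms by (intro subset_antisym regular_closed_subset_almost[where N = N]) auto

text \<open>
  The principle that transfers Boolean laws from sets to polytopes: it suffices to check an identity
  at points away from the boundaries of the sets it involves.
\<close>
lemma flat_boundary_eqI: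
  assumes "flat_boundary A" "flat_boundary B"
    and "finite F" "\<And>C. C \<in> F \<Longrightarrow> flat_boundary C"
    and "\<And>x. (\<And>C. C \<in> F \<Longrightarrow> x \<notin> frontier C) \<Longrightarrow> x \<in> A \<longleftrightarrow> x \<in> B"
  shows "A = B"
proof (rule regular_closed_eq_almost)
  show "negligible (\<Union>C\<in>F. frontier C)"
    using assms(3,4) by (intro negligible_Union) (auto simp: flat_boundary_negligible_frontier)
  show "x \<in> A \<longleftrightarrow> x \<in> B" if "x \<notin> (\<Union>C\<in>F. frontier C)" for x
    using that by (intro assms(5)) auto
qed (use assms in \<open>auto simp: flat_boundary_regular_closed\<close>)

lemma notin_frontier_Un: "x \<notin> frontier A \<Longrightarrow> x \<notin> frontier B \<Longrightarrow> x \<notin> frontier (A \<union> B)"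
  using frontier_Un_subset by blast

lemma notin_frontier_reg_meet:
  "x \<notin> frontier A \<Longrightarrow> x \<notin> frontier B \<Longrightarrow> x \<notin> frontier (reg_meet A B)"
  using frontier_reg_meet_subset by blast

lemma notin_frontier_reg_compl:
  "closed A \<Longrightarrow> x \<notin> frontier A \<Longrightarrow> x \<notin> frontier (reg_compl A)"
  using frontier_reg_compl_subset by blast

lemmas flat_boundary_intros =
  flat_boundary_Un flat_boundary_reg_meet flat_boundary_reg_compl flat_boundary_empty
  flat_boundary_UNIV

lemmas off_frontier_simps =
  flat_boundary_intros flat_boundary_closed closed_Un reg_meet_off_frontiers
  reg_compl_off_frontier notin_frontier_Un notin_frontier_reg_meet notin_frontier_reg_compl

lemma polytopes_flat_boundary:
  assumes "A \<in> polytopes"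
  shows "flat_boundary A"
proof -
  have "flat_boundary Q" if "basic_polytope Q" for Q :: "'a set"
    using that unfolding basic_polytope_def
    by (auto intro!: flat_boundary_reg_Inter intro: flat_boundary_closed_halfspace)
  then show ?thesis
    using assms by (auto simp: polytopes_def intro!: flat_boundary_Union)
qed

lemma basic_polytope_polytopes: "basic_polytope Q \<Longrightarrow> Q \<in> polytopes"
  unfolding polytopes_def by (auto intro!: exI[of _ "{Q}"])

lemma polytopes_Union:
  assumes "finite F" "F \<subseteq> polytopes"
  shows "\<Union>F \<in> polytopes"
  using assms
proof (induction F)
  case empty
  then show ?case
    unfolding polytopes_def by (auto intro!: exI[of _ "{}"])
next
  case (insert A F)
  then obtain G G' where "\<Union>F = \<Union>G" "finite G" "\<forall>Q\<in>G. basic_polytope Q"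
    and "A = \<Union>G'" "finite G'" "\<forall>Q\<in>G'. basic_polytope Q"
    unfolding polytopes_def by auto
  then show ?case
    unfolding polytopes_def by (auto intro!: exI[of _ "G \<union> G'"])
qed

lemma polytopes_Un: "A \<in> polytopes \<Longrightarrow> B \<in> polytopes \<Longrightarrow> A \<union> B \<in> polytopes"
  using polytopes_Union[of "{A, B}"] by auto

lemma polytopes_UNIV: "UNIV \<in> polytopes"
  by (rule basic_polytope_polytopes) (auto simp: basic_polytope_def reg_Inter_def intro!: exI[of _ "{}"])

lemma basic_polytope_reg_meet:
  assumes "basic_polytope Q" "basic_polytope R"
  shows "basic_polytope (reg_meet Q R)"
proof -
  obtain F G where F: "finite F" "\<forall>H\<in>F. closed_halfspace H" "Q = reg_Inter F"
    and G: "finite G" "\<forall>H\<in>G. closed_halfspace H" "R = reg_Inter G"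
    using assms by (auto simp: basic_polytope_def)
  have flat: "\<forall>H\<in>F \<union> G. flat_boundary H"
    using F(2) G(2) by (auto intro: flat_boundary_closed_halfspace)
  have "reg_meet Q R = reg_Inter (F \<union> G)"
  proof (rule flat_boundary_eqI[where F = "F \<union> G"])
    fix x assume x: "\<And>C. C \<in> F \<union> G \<Longrightarrow> x \<notin> frontier C"
    have "x \<notin> frontier Q" "x \<notin> frontier R"
      using x frontier_reg_Inter_subset F(1,3) G(1,3) by blast+
    then have "x \<in> reg_meet Q R \<longleftrightarrow> x \<in> Q \<and> x \<in> R"
      by (simp add: reg_meet_off_frontiers F(3) G(3) regular_closed_imp_closed regular_closed_reg_Inter)
    also have "\<dots> \<longleftrightarrow> x \<in> reg_Inter (F \<union> G)"
      using x flat F(1) G(1) unfolding F(3) G(3)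
      by (subst (1 2 3) reg_Inter_off_frontiers) (auto simp: flat_boundary_closed)
    finally show "x \<in> reg_meet Q R \<longleftrightarrow> x \<in> reg_Inter (F \<union> G)" .
  qed (use flat F G in \<open>auto intro!: flat_boundary_reg_meet flat_boundary_reg_Inter\<close>)
  then show ?thesis
    using F G unfolding basic_polytope_def by (auto intro!: exI[of _ "F \<union> G"])
qed

lemma reg_meet_Un_right:
  assumes "flat_boundary A" "flat_boundary B" "flat_boundary C"
  shows "reg_meet A (B \<union> C) = reg_meet A B \<union> reg_meet A C"
  using assms by (intro flat_boundary_eqI[where F = "{A, B, C}"]) (auto simp: off_frontier_simps)

lemma reg_meet_commute: "reg_meet A B = reg_meet B A"
  by (simp add: reg_meet_def Int_commute)

text \<open>
  Peeling off one basic polytope at a time turns distributivity and De Morgan for two sets into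
  statements about finite unions.
\<close>
lemma polytopes_induct [consumes 1, case_names empty basic_Un]:
  assumes "A \<in> polytopes" "P {}"
    and "\<And>Q B. basic_polytope Q \<Longrightarrow> B \<in> polytopes \<Longrightarrow> P B \<Longrightarrow> P (Q \<union> B)"
  shows "P A"
proof -
  obtain F where F: "finite F" "\<forall>Q\<in>F. basic_polytope Q" "A = \<Union>F"
    using assms(1) by (auto simp: polytopes_def)
  from F(1,2) have "P (\<Union>F)"
  proof (induction F)
    case empty
    then show ?case using assms(2) by simp
  next
    case (insert Q F)
    moreover have "\<Union>F \<in> polytopes"
      using insert by (auto simp: polytopes_def)
    ultimately show ?case
      using assms(3)[of Q "\<Union>F"] by simp
  qed
  with F(3) show ?thesis by simp
qed

lemma reg_meet_empty: "reg_meet A {} = {}"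
  by (simp add: reg_meet_def)

lemma polytopes_empty: "{} \<in> polytopes"
  using polytopes_Union[of "{}"] by simp

lemma polytopes_reg_meet:
  assumes "A \<in> polytopes" "B \<in> polytopes"
  shows "reg_meet A B \<in> polytopes"
  using assms(2)
proof (induction B rule: polytopes_induct)
  case empty
  then show ?case by (simp add: reg_meet_empty polytopes_empty)
next
  case (basic_Un Q B)
  have "reg_meet Q A \<in> polytopes"
    using assms(1)
  proof (induction A rule: polytopes_induct)
    case empty
    then show ?case by (simp add: reg_meet_empty polytopes_empty)
  next
    case (basic_Un R C)
    then have "reg_meet Q (R \<union> C) = reg_meet Q R \<union> reg_meet Q C"
      using \<open>basic_polytope Q\<close>
      by (intro reg_meet_Un_right) (auto intro: polytopes_flat_boundary basic_polytope_polytopes)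
    then show ?case
      using basic_Un \<open>basic_polytope Q\<close>
      by (simp add: polytopes_Un basic_polytope_reg_meet basic_polytope_polytopes)
  qed
  moreover have "reg_meet A (Q \<union> B) = reg_meet A Q \<union> reg_meet A B"
    using basic_Un assms(1)
    by (intro reg_meet_Un_right) (auto intro: polytopes_flat_boundary basic_polytope_polytopes)
  ultimately show ?case
    using basic_Un by (simp add: polytopes_Un reg_meet_commute)
qed

lemma closed_halfspace_reg_compl:
  assumes "closed_halfspace H"
  shows "closed_halfspace (reg_compl H)"
proof -
  obtain c d where c: "c \<noteq> 0" and H: "H = {x. c \<bullet> x \<le> d}"
    using assms by (auto simp: closed_halfspace_def)
  have "- H = {x. c \<bullet> x > d}"
    by (auto simp: H)
  then have "reg_compl H = {x. (- c) \<bullet> x \<le> - d}"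
    using c by (simp add: reg_compl_def)
  with c show ?thesis
    unfolding closed_halfspace_def by (metis neg_equal_0_iff_equal)
qed

lemma closed_halfspace_polytopes:
  assumes "closed_halfspace H"
  shows "H \<in> polytopes"
proof (rule basic_polytope_polytopes)
  have "H = reg_Inter {H}"
    using flat_boundary_regular_closed[OF flat_boundary_closed_halfspace[OF assms]]
    by (simp add: reg_Inter_def regular_closed_def)
  with assms show "basic_polytope H"
    unfolding basic_polytope_def by (intro exI[of _ "{H}"]) auto
qed

text \<open>
  De Morgan: the complement of a regularised intersection of half-spaces is the union of the opposite
  half-spaces.
\<close>
lemma polytopes_reg_compl_basic:
  assumes "basic_polytope Q"
  shows "reg_compl Q \<in> polytopes"
proof -
  obtain F where F: "finite F" "\<forall>H\<in>F. closed_halfspace H" "Q = reg_Inter F"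
    using assms by (auto simp: basic_polytope_def)
  have flat: "\<forall>H\<in>F. flat_boundary H"
    using F(2) by (auto intro: flat_boundary_closed_halfspace)
  have "reg_compl Q = (\<Union>H\<in>F. reg_compl H)"
  proof (rule flat_boundary_eqI[where F = F])
    show "flat_boundary (reg_compl Q)"
      using assms by (intro flat_boundary_reg_compl polytopes_flat_boundary basic_polytope_polytopes)
    show "flat_boundary (\<Union>H\<in>F. reg_compl H)"
      using F(1) flat by (intro flat_boundary_Union) (auto intro: flat_boundary_reg_compl)
    fix x assume x: "\<And>C. C \<in> F \<Longrightarrow> x \<notin> frontier C"
    have "x \<notin> frontier Q"
      using x frontier_reg_Inter_subset F(1,3) by blast
    then have "x \<in> reg_compl Q \<longleftrightarrow> x \<notin> \<Inter>F"
      using x flat F(1) unfolding F(3)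
      by (simp add: reg_compl_off_frontier reg_Inter_off_frontiers flat_boundary_closed)
    also have "\<dots> \<longleftrightarrow> x \<in> (\<Union>H\<in>F. reg_compl H)"
      using x by (auto simp: reg_compl_off_frontier)
    finally show "x \<in> reg_compl Q \<longleftrightarrow> x \<in> (\<Union>H\<in>F. reg_compl H)" .
  qed (use F flat in auto)
  then show ?thesis
    using F(1,2)
    by (auto intro!: polytopes_Union closed_halfspace_polytopes[OF closed_halfspace_reg_compl])
qed

lemma polytopes_reg_compl:
  assumes "A \<in> polytopes"
  shows "reg_compl A \<in> polytopes"
  using assms
proof (induction A rule: polytopes_induct)
  case empty
  then show ?case by (simp add: reg_compl_def polytopes_UNIV)
next
  case (basic_Un Q B)
  have flat: "flat_boundary Q" "flat_boundary B"
    using basic_Un by (auto intro: polytopes_flat_boundary basic_polytope_polytopes)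
  then have "reg_compl (Q \<union> B) = reg_meet (reg_compl Q) (reg_compl B)"
    by (intro flat_boundary_eqI[where F = "{Q, B}"]) (auto simp: off_frontier_simps)
  then show ?case
    using basic_Un by (simp add: polytopes_reg_meet polytopes_reg_compl_basic)
qed

lemma boolean_algebra_on_polytopes:
  "boolean_algebra_on (polytopes :: 'a::euclidean_space set set) reg_meet (\<union>) reg_compl {} UNIV"
proof (unfold_locales, goal_cases)
  case (6 x y z)
  then show ?case
    by (intro flat_boundary_eqI[where F = "{x, y, z}"])
      (auto simp: off_frontier_simps polytopes_flat_boundary)
next
  case (10 x y z)
  then show ?case
    by (intro reg_meet_Un_right polytopes_flat_boundary)
next
  case (11 x y z)
  then show ?case
    by (intro flat_boundary_eqI[where F = "{x, y, z}"])
      (auto simp: off_frontier_simps polytopes_flat_boundary)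
next
  case (12 x)
  then show ?case
    by (intro flat_boundary_eqI[where F = "{x, UNIV}"])
      (auto simp: off_frontier_simps polytopes_flat_boundary)
next
  case (14 x)
  then show ?case
    by (intro flat_boundary_eqI[where F = "{x}"])
      (auto simp: off_frontier_simps polytopes_flat_boundary)
next
  case (15 x)
  then show ?case
    by (intro flat_boundary_eqI[where F = "{x}"])
      (auto simp: off_frontier_simps polytopes_flat_boundary)
qed (auto simp: polytopes_reg_meet polytopes_Un polytopes_reg_compl polytopes_empty polytopes_UNIV
    reg_meet_commute)

section \<open>Segments in general position\<close>

text \<open>
  The points \<open>x\<close> whose segment from \<open>e\<close> hits \<open>h \<inter> h'\<close> lie in the affine hull of \<open>e\<close> and \<open>h \<inter> h'\<close>.
  That hull is proper because \<open>h \<inter> h'\<close> has codimension at least two; concretely, it lies in the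
  hyperplane of the pencil spanned by \<open>h\<close> and \<open>h'\<close> that passes through \<open>e\<close>.
\<close>
lemma segments_through_hyperplane_Int:
  fixes e :: "'a::euclidean_space"
  assumes "hyperplane h" "hyperplane h'" "h \<noteq> h'" "e \<notin> h \<inter> h'"
  shows "\<exists>k. hyperplane k \<and> {x. closed_segment e x \<inter> h \<inter> h' \<noteq> {}} \<subseteq> k"
proof -
  obtain c d where c: "c \<noteq> 0" and h: "h = {x. c \<bullet> x = d}"
    using assms(1) by (auto simp: hyperplane_def)
  obtain c' d' where c': "c' \<noteq> 0" and h': "h' = {x. c' \<bullet> x = d'}"
    using assms(2) by (auto simp: hyperplane_def)
  define \<alpha> where "\<alpha> = c \<bullet> e - d"
  define \<alpha>' where "\<alpha>' = c' \<bullet> e - d'"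
  \<comment> \<open>Normal of the pencil member \<open>\<alpha> (c' \<bullet> x - d') = \<alpha>' (c \<bullet> x - d)\<close> through \<open>e\<close>; it is nonzero,
    since otherwise the equations of \<open>h\<close> and \<open>h'\<close> would be proportional.\<close>
  define n where "n = \<alpha> *\<^sub>R c' - \<alpha>' *\<^sub>R c"
  have off: "\<alpha> \<noteq> 0 \<or> \<alpha>' \<noteq> 0"
    using assms(4) by (auto simp: \<alpha>_def \<alpha>'_def h h')
  have "n \<noteq> 0"
  proof
    assume n: "n = 0"
    then have eq: "\<alpha> *\<^sub>R c' = \<alpha>' *\<^sub>R c"
      by (simp add: n_def)
    with off c c' have nz: "\<alpha> \<noteq> 0" "\<alpha>' \<noteq> 0"
      by auto
    have "\<alpha> * (c' \<bullet> x - d') = \<alpha>' * (c \<bullet> x - d)" for x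
    proof -
      have *: "\<alpha> * (c' \<bullet> y) = \<alpha>' * (c \<bullet> y)" for y
        using arg_cong[OF eq, of "\<lambda>v. v \<bullet> y"] by simp
      have "\<alpha> * (c' \<bullet> e - d') = \<alpha>' * (c \<bullet> e - d)"
        by (simp add: \<alpha>_def \<alpha>'_def)
      then show ?thesis
        using *[of e] *[of x] by (simp add: algebra_simps)
    qed
    then have "c \<bullet> x - d = 0 \<longleftrightarrow> c' \<bullet> x - d' = 0" for x
      using nz by (metis mult_eq_0_iff)
    then have "h = h'"
      by (simp add: h h')
    with assms(3) show False ..
  qed
  moreover have "n \<bullet> x = \<alpha> * d' - \<alpha>' * d" if x: "closed_segment e x \<inter> h \<inter> h' \<noteq> {}" for x
  proof -
    obtain u where u: "c \<bullet> ((1 - u) *\<^sub>R e + u *\<^sub>R x) = d" "c' \<bullet> ((1 - u) *\<^sub>R e + u *\<^sub>R x) = d'"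
      using x by (auto simp: closed_segment_def h h')
    have s: "(1 - u) * \<alpha> + u * (c \<bullet> x - d) = 0" "(1 - u) * \<alpha>' + u * (c' \<bullet> x - d') = 0"
      using u by (auto simp: \<alpha>_def \<alpha>'_def inner_simps algebra_simps)
    \<comment> \<open>The point with parameter \<open>u = 0\<close> is \<open>e\<close>, which is off \<open>h \<inter> h'\<close>.\<close>
    have "u \<noteq> 0"
      using s off by auto
    moreover have "u * (\<alpha> * (c' \<bullet> x - d') - \<alpha>' * (c \<bullet> x - d)) = 0"
      using s by algebra
    ultimately have "\<alpha> * (c' \<bullet> x - d') = \<alpha>' * (c \<bullet> x - d)"
      by simp
    then show ?thesis
      by (simp add: n_def inner_simps algebra_simps)
  qed
  ultimately show ?thesis
    by (intro exI[of _ "{x. n \<bullet> x = \<alpha> * d' - \<alpha>' * d}"]) (auto simp: hyperplane_def)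
qed

text \<open>
  With \<open>a\<close> off all hyperplanes, the end points \<open>b\<close> that are bad for some pair of hyperplanes fill
  only finitely many hyperplanes, so they cannot exhaust \<open>V\<close>.
\<close>
lemma generic_segment:
  fixes U V :: "'a::euclidean_space set"
  assumes "finite \<H>" "\<And>h. h \<in> \<H> \<Longrightarrow> hyperplane h"
    and "open U" "U \<noteq> {}" "open V" "V \<noteq> {}"
  obtains a b where "a \<in> U" "b \<in> V"
    "\<And>h h'. h \<in> \<H> \<Longrightarrow> h' \<in> \<H> \<Longrightarrow> h \<noteq> h' \<Longrightarrow> closed_segment a b \<inter> h \<inter> h' = {}"
proof -
  have "negligible (\<Union>\<H>)"
    using assms(1,2) by (intro negligible_Union) (auto simp: hyperplane_negligible)
  then obtain a where a: "a \<in> U" "a \<notin> \<Union>\<H>"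
    using open_meets_Compl_negligible assms(3,4) by metis
  define P where "P = {(h, h'). h \<in> \<H> \<and> h' \<in> \<H> \<and> h \<noteq> h'}"
  define bad where "bad = (\<lambda>(h, h'). {x. closed_segment a x \<inter> h \<inter> h' \<noteq> {}})"
  have "P \<subseteq> \<H> \<times> \<H>"
    by (auto simp: P_def)
  then have "finite P"
    using assms(1) by (simp add: finite_subset)
  moreover have "negligible (bad p)" if p: "p \<in> P" for p
  proof -
    obtain h h' where hh': "p = (h, h')" "h \<in> \<H>" "h' \<in> \<H>" "h \<noteq> h'"
      using p by (auto simp: P_def)
    then have "\<exists>k. hyperplane k \<and> bad p \<subseteq> k"
      unfolding bad_def using segments_through_hyperplane_Int[of h h' a] a(2) assms(2) by auto
    then show ?thesis
      using hyperplane_negligible negligible_subset by blast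
  qed
  ultimately have "negligible (\<Union>(bad ` P))"
    by (intro negligible_Union) auto
  then obtain b where b: "b \<in> V" "b \<notin> \<Union>(bad ` P)"
    using open_meets_Compl_negligible assms(5,6) by metis
  show ?thesis
  proof (rule that[OF a(1) b(1)])
    show "closed_segment a b \<inter> h \<inter> h' = {}" if "h \<in> \<H>" "h' \<in> \<H>" "h \<noteq> h'" for h h'
      using b(2) that by (auto simp: P_def bad_def)
  qed
qed

section \<open>Splitting a contact with a union\<close>

lemma connected_closed_cover_Int:
  assumes "connected E" "closed A" "closed B" "E \<subseteq> A \<union> B" "E \<inter> A \<noteq> {}" "E \<inter> B \<noteq> {}"
  shows "E \<inter> A \<inter> B \<noteq> {}"
  using assms unfolding connected_closed by blast

text \<open>
  Near \<open>p\<close> all boundaries lie in one hyperplane \<open>k\<close>, so a small ball has just two cells. Each of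
  \<open>X\<close>, \<open>Y\<close> contains at least one of them, being regular closed; a cell that both miss is covered by
  \<open>Z\<close>.
\<close>
lemma SC_Un_at_generic_point:
  fixes X Y Z :: "'a::euclidean_space set"
  assumes flat: "flat_boundary X" "flat_boundary Y" "flat_boundary Z"
    and \<H>: "finite \<H>" "\<And>h. h \<in> \<H> \<Longrightarrow> hyperplane h"
      "frontier X \<union> frontier Y \<union> frontier Z \<subseteq> \<Union>\<H>"
    and E: "open E" "E \<subseteq> X \<union> Y \<union> Z"
    and p: "p \<in> E" "p \<in> X" "p \<in> Y"
    and generic: "\<And>h h'. h \<in> \<H> \<Longrightarrow> h' \<in> \<H> \<Longrightarrow> p \<in> h \<Longrightarrow> p \<in> h' \<Longrightarrow> h = h'"
  shows "SC X Y \<or> SC X Z"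
proof -
  obtain k where k: "hyperplane k" "p \<in> k" "\<And>h. h \<in> \<H> \<Longrightarrow> p \<in> h \<Longrightarrow> h = k"
  proof (cases "\<exists>h\<in>\<H>. p \<in> h")
    case True
    with that generic \<H>(2) show ?thesis by blast
  next
    case False
    \<comment> \<open>With no boundary nearby, cutting by an arbitrary hyperplane through \<open>p\<close> saves a separate case.\<close>
    obtain c :: 'a where "c \<in> Basis" using nonempty_Basis by blast
    then have "c \<noteq> 0" by auto
    then have "hyperplane {x. c \<bullet> x = c \<bullet> p}"
      unfolding hyperplane_def by blast
    with False that show ?thesis by blast
  qed
  then obtain c d where c: "c \<noteq> 0" and keq: "k = {x. c \<bullet> x = d}"
    by (auto simp: hyperplane_def)
  have "closed (\<Union>(\<H> - {k}))"
    using \<H> by (intro closed_Union) (auto simp: hyperplane_closed)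
  moreover have "p \<notin> \<Union>(\<H> - {k})"
    using k(3) by blast
  ultimately have "open (E - \<Union>(\<H> - {k}))" "p \<in> E - \<Union>(\<H> - {k})"
    using E(1) p(1) by (auto intro: open_Diff)
  then obtain r where r: "r > 0" "ball p r \<subseteq> E - \<Union>(\<H> - {k})"
    by (metis open_contains_ball)
  define B where "B = ball p r"
  define D1 where "D1 = B \<inter> {x. c \<bullet> x < d}"
  define D2 where "D2 = B \<inter> {x. c \<bullet> x > d}"
  have pB: "p \<in> B" "open B" "connected B" "B \<subseteq> E"
    using r by (auto simp: B_def)
  have conn: "connected D1" "connected D2"
    by (auto simp: D1_def D2_def B_def intro!: convex_connected convex_Int
        convex_halfspace_lt convex_halfspace_gt)
  have "k \<subseteq> - (D1 \<union> D2)"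
    by (auto simp: keq D1_def D2_def)
  then have avoid: "D \<inter> \<Union>\<H> = {}" if "D = D1 \<or> D = D2" for D
    using that r(2) unfolding B_def[symmetric] D1_def D2_def by blast
  have const: "D \<subseteq> A \<or> D \<inter> A = {}"
    if "A = X \<or> A = Y \<or> A = Z" "D = D1 \<or> D = D2" for A D
  proof (rule ccontr)
    assume *: "\<not> ?thesis"
    have "connected D"
      using conn that(2) by auto
    with * have "D \<inter> frontier A \<noteq> {}"
      using connected_Int_frontier[of D A] by blast
    with avoid[OF that(2)] \<H>(3) that(1) show False by blast
  qed
  have dense: "U \<inter> (D1 \<union> D2) \<noteq> {}" if U: "open U" "U \<inter> B \<noteq> {}" for U
  proof -
    have "open (U \<inter> B)"
      using U(1) pB(2) by (rule open_Int)
    then obtain x where "x \<in> U \<inter> B" "x \<notin> k"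
      using open_meets_Compl_negligible U(2) hyperplane_negligible[OF k(1)] by metis
    then show ?thesis
      by (auto simp: keq D1_def D2_def)
  qed
  have nonempty: "D1 \<noteq> {}" "D2 \<noteq> {}"
  proof -
    define t where "t = r / (2 * norm c)"
    have t: "t > 0" "t * norm c < r"
      using r(1) c by (auto simp: t_def)
    have "p - t *\<^sub>R c \<in> B" "p + t *\<^sub>R c \<in> B"
      using t by (auto simp: B_def dist_norm)
    moreover have "c \<bullet> p = d" "0 < t * (c \<bullet> c)"
      using k(2) keq t(1) c by auto
    ultimately have "p - t *\<^sub>R c \<in> D1" "p + t *\<^sub>R c \<in> D2"
      by (auto simp: D1_def D2_def inner_simps)
    then show "D1 \<noteq> {}" "D2 \<noteq> {}" by auto
  qed
  have half: "D1 \<subseteq> A \<or> D2 \<subseteq> A" if "A = X \<or> A = Y" for A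
  proof -
    have "B \<inter> interior A \<noteq> {}"
      using that flat p pB by (intro open_meets_interior) (auto simp: flat_boundary_regular_closed)
    then have "interior A \<inter> (D1 \<union> D2) \<noteq> {}"
      by (intro dense) auto
    then have "A \<inter> D1 \<noteq> {} \<or> A \<inter> D2 \<noteq> {}"
      using interior_subset by blast
    with const[of A] that show ?thesis by blast
  qed
  \<comment> \<open>The two open halves are dense in the ball, so closed sets covering them cover the ball.\<close>
  have fill: "SC A C" if "closed A" "closed C" "D1 \<union> D2 \<subseteq> A \<union> C" "B \<inter> A \<noteq> {}" "B \<inter> C \<noteq> {}" for A C
  proof -
    have "open (- (A \<union> C))"
      using that(1,2) by (intro open_Compl closed_Un)
    then have "B \<subseteq> A \<union> C"
      using dense[of "- (A \<union> C)"] that(3) by blast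
    with that pB show ?thesis
      unfolding SC_def by blast
  qed
  show ?thesis
  proof (cases "D1 \<union> D2 \<subseteq> X \<union> Y")
    case True
    then show ?thesis
      using fill[of X Y] flat p pB by (auto simp: flat_boundary_closed)
  next
    case False
    obtain D D' where D: "D \<union> D' = D1 \<union> D2" "D = D1 \<or> D = D2" "D' = D1 \<or> D' = D2"
      "D \<subseteq> X" "\<not> D' \<subseteq> X \<union> Y"
      using half[of X] False by (metis Un_commute le_supI sup.coboundedI1)
    then have "D' \<inter> X = {}" "D' \<inter> Y = {}"
      using const[of X D'] const[of Y D'] by auto
    moreover have "D' \<subseteq> B"
      using D(3) by (auto simp: D1_def D2_def)
    ultimately have "D' \<subseteq> Z" "B \<inter> Z \<noteq> {}"
      using D(3) nonempty E(2) pB(4) by blast+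
    then have "SC X Z"
      using fill[of X Z] flat p pB D by (auto simp: flat_boundary_closed)
    then show ?thesis ..
  qed
qed

text \<open>
  Reduces to a generic point: connectedness is used once for \<open>E\<close>, to localise to a ball, and once for
  a generic segment in that ball, to get off the intersections of hyperplanes.
\<close>
lemma SC_Un_imp:
  fixes X Y Z :: "'a::euclidean_space set"
  assumes flat: "flat_boundary X" "flat_boundary Y" "flat_boundary Z"
    and SC: "SC X (Y \<union> Z)"
  shows "SC X Y \<or> SC X Z"
proof -
  obtain E where E: "open E" "connected E" "E \<subseteq> X \<union> (Y \<union> Z)" "E \<inter> X \<noteq> {}" "E \<inter> (Y \<union> Z) \<noteq> {}"
    using SC by (auto simp: SC_def)
  have YZ: "flat_boundary (Y \<union> Z)"
    using flat by (simp add: flat_boundary_Un)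
  obtain \<H>1 \<H>2 \<H>3 where
    "finite \<H>1" "\<forall>h\<in>\<H>1. hyperplane h" "frontier X \<subseteq> \<Union>\<H>1"
    "finite \<H>2" "\<forall>h\<in>\<H>2. hyperplane h" "frontier Y \<subseteq> \<Union>\<H>2"
    "finite \<H>3" "\<forall>h\<in>\<H>3. hyperplane h" "frontier Z \<subseteq> \<Union>\<H>3"
    using flat unfolding flat_boundary_def by metis
  moreover define \<H> where "\<H> = \<H>1 \<union> \<H>2 \<union> \<H>3"
  ultimately have \<H>: "finite \<H>" "\<And>h. h \<in> \<H> \<Longrightarrow> hyperplane h"
    "frontier X \<union> frontier Y \<union> frontier Z \<subseteq> \<Union>\<H>"
    by auto
  obtain q where q: "q \<in> E" "q \<in> X" "q \<in> Y \<union> Z"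
    using connected_closed_cover_Int[OF E(2) _ _ E(3-5)] flat YZ
    by (auto simp: flat_boundary_closed)
  obtain r where r: "r > 0" "ball q r \<subseteq> E"
    using E(1) q(1) open_contains_ball by blast
  have "q \<in> ball q r"
    using r(1) by simp
  then have "ball q r \<inter> interior X \<noteq> {}" "ball q r \<inter> interior (Y \<union> Z) \<noteq> {}"
    using q(2,3) flat(1) YZ flat_boundary_regular_closed
    by (metis open_meets_interior open_ball disjoint_iff)+
  then obtain a b where ab: "a \<in> ball q r \<inter> interior X" "b \<in> ball q r \<inter> interior (Y \<union> Z)"
    "\<And>h h'. h \<in> \<H> \<Longrightarrow> h' \<in> \<H> \<Longrightarrow> h \<noteq> h' \<Longrightarrow> closed_segment a b \<inter> h \<inter> h' = {}"
    using generic_segment[OF \<H>(1,2), of "ball q r \<inter> interior X" "ball q r \<inter> interior (Y \<union> Z)"]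
    by (metis open_Int open_ball open_interior)
  have "closed_segment a b \<subseteq> ball q r"
    using ab(1,2) by (intro closed_segment_subset) auto
  with r(2) have sub: "closed_segment a b \<subseteq> E" by blast
  have "closed_segment a b \<inter> X \<inter> (Y \<union> Z) \<noteq> {}"
  proof (rule connected_closed_cover_Int)
    show "closed_segment a b \<inter> X \<noteq> {}"
      using ab(1) interior_subset ends_in_segment(1) by blast
    show "closed_segment a b \<inter> (Y \<union> Z) \<noteq> {}"
      using ab(2) interior_subset ends_in_segment(2) by blast
  qed (use sub E(3) flat YZ in \<open>auto simp: flat_boundary_closed\<close>)
  then obtain p where p: "p \<in> closed_segment a b" "p \<in> X" "p \<in> Y \<or> p \<in> Z"
    by blast
  have generic: "h = h'" if "h \<in> \<H>" "h' \<in> \<H>" "p \<in> h" "p \<in> h'" for h h'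
    using ab(3) that p(1) by blast
  from p(3) show ?thesis
  proof
    assume "p \<in> Y"
    with flat \<H> E(1,3) sub p generic show ?thesis
      by (intro SC_Un_at_generic_point[of X Y Z \<H> E p]) auto
  next
    assume "p \<in> Z"
    with flat \<H> E(1,3) sub p generic have "SC X Z \<or> SC X Y"
      by (intro SC_Un_at_generic_point[of X Z Y \<H> E p]) auto
    then show ?thesis by blast
  qed
qed

lemma SC_mono: "SC A B \<Longrightarrow> B \<subseteq> B' \<Longrightarrow> SC A B'"
  unfolding SC_def by blast

lemma SC_self:
  fixes A :: "'a::euclidean_space set"
  assumes "flat_boundary A" "A \<noteq> {}"
  shows "SC A A"
proof -
  have "interior A \<noteq> {}"
    using open_meets_interior[of A UNIV] assms by (auto simp: flat_boundary_regular_closed)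
  then obtain x r where "r > 0" "ball x r \<subseteq> interior A"
    using open_contains_ball open_interior by blast
  moreover from this have "ball x r \<subseteq> A" "x \<in> ball x r"
    using interior_subset by auto
  ultimately show ?thesis
    unfolding SC_def by (intro exI[of _ "ball x r"]) (blast intro: open_ball connected_ball)
qed

lemma SC_sym: "SC A B \<Longrightarrow> SC B A"
  unfolding SC_def by (metis Un_commute)

lemma not_SC_empty: "\<not> SC {} A"
  by (simp add: SC_def)

theorem mainTheorem1:
  shows "contact_relation (polytopes :: (real ^ 'n) set set) reg_meet (\<union>) reg_compl {} UNIV
           {(A, B). A \<in> polytopes \<and> B \<in> polytopes \<and> SC A B}"
proof (intro contact_relation.intro boolean_algebra_on_polytopes, unfold_locales)
  fix X Y Z :: "(real ^ 'n) set"
  assume "X \<in> polytopes" "Y \<in> polytopes" "Z \<in> polytopes"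
  then show "(X, Y \<union> Z) \<in> {(A, B). A \<in> polytopes \<and> B \<in> polytopes \<and> SC A B} \<longleftrightarrow>
      (X, Y) \<in> {(A, B). A \<in> polytopes \<and> B \<in> polytopes \<and> SC A B} \<or>
      (X, Z) \<in> {(A, B). A \<in> polytopes \<and> B \<in> polytopes \<and> SC A B}"
    using SC_Un_imp[of X Y Z] SC_mono[of X Y "Y \<union> Z"] SC_mono[of X Z "Y \<union> Z"]
    by (auto simp: polytopes_flat_boundary polytopes_Un)
qed (auto simp: not_SC_empty intro: SC_sym SC_self polytopes_flat_boundary)

end
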